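(* Let $d\ge 1$ and $q\ge 2$ be integers. There exists a frozen $q$-coloring of $\mathbb{Z}^d$ if and only if $2\le q\le d+1$.
   Context: $\mathbb{Z}^d$ is regarded as a graph in which two vertices are adjacent iff they differ by a standard unit vector (so each vertex has $2d$ neighbors). A (proper) $q$-coloring of a graph is an assignment of colors from a fixed set of size $q$ (e.g. $\{0,1,\dots,q-1\}$) to its vertices such that adjacent vertices receive different colors. A $q$-coloring $x$ of $\mathbb{Z}^d$ is frozen if every $q$-coloring of $\mathbb{Z}^d$ that differs from $x$ on only finitely many vertices is identical to $x$. *)

theory Defs
  imports "HOL-Analysis.Finite_Cartesian_Product"
begin

text \<open>
  The grid \<open>\<int>\<^sup>d\<close> is the type \<open>int ^ 'd\<close>, where \<open>'d\<close> ranges over the (nonempty) finite types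
  and \<open>d = CARD('d)\<close>; \<open>axis i 1\<close> is the standard unit vector in direction \<open>i\<close>.
\<close>

definition grid_adj :: "int ^ 'd \<Rightarrow> int ^ 'd \<Rightarrow> bool" where
  "grid_adj u v \<longleftrightarrow> (\<exists>i. v = u + axis i 1 \<or> u = v + axis i 1)"

text \<open>The colors are \<open>0, \<dots>, q - 1\<close>, and every element of the type \<open>'v\<close> is a vertex.\<close>

definition proper_coloring :: "('v \<Rightarrow> 'v \<Rightarrow> bool) \<Rightarrow> nat \<Rightarrow> ('v \<Rightarrow> nat) \<Rightarrow> bool" where
  "proper_coloring adj q x \<longleftrightarrow>
     (\<forall>v. x v \<in> {0..<q}) \<and> (\<forall>u v. adj u v \<longrightarrow> x u \<noteq> x v)"

definition frozen_coloring :: "nat \<Rightarrow> (int ^ 'd \<Rightarrow> nat) \<Rightarrow> bool" where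
  "frozen_coloring q x \<longleftrightarrow>
     proper_coloring grid_adj q x \<and>
     (\<forall>y. proper_coloring grid_adj q y \<and> finite {v. y v \<noteq> x v} \<longrightarrow> y = x)"

end

theory Submission imports Defs
begin

text \<open>
  If \<open>q \<le> d + 1\<close>, choose steps \<open>s i\<close> that exhaust \<open>{1..q - 1}\<close> and color \<open>v\<close> by
  \<open>\<Sum>i. s i * v $ i\<close> modulo \<open>q\<close>: the forward neighbors of \<open>v\<close> carry all the colors other than
  that of \<open>v\<close>, so a finite change is impossible at a changed vertex of maximal coordinate sum.

  If \<open>q \<ge> d + 2\<close>, let \<open>n = d + 1\<close> and recolor the box \<open>{0..d}\<^sup>d\<close>, using that a bipartite digraph
  is colorable from lists that are larger than the out-degrees (Bondy, Boppana and Siegel). A box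
  vertex with \<open>k\<close> neighbors outside has at least \<open>q - k\<close> available colors. Each line of the box in
  direction \<open>i\<close> contains exactly one vertex whose coordinate sum is congruent modulo \<open>n\<close> to the
  label of \<open>i\<close> in \<open>{1..d}\<close>; orient the line away from that vertex. Every vertex is the source of
  at most one line, so its out-degree is at most \<open>d + 1 - k\<close>; the origin is the source of no line,
  so its present color can be deleted from its list.
\<close>

section \<open>Kernels and list coloring of bipartite digraphs\<close>

text \<open>\<open>K\<close> is a kernel: independent, and absorbing the rest of \<open>S\<close>.
  If every vertex with \<open>P\<close> has an out-neighbor without \<open>P\<close> in
  \<open>S\<close>, the vertices without \<open>P\<close> form one. Otherwise some sink joins the
  kernel of what remains after deleting it and its in-neighbors.\<close>

lemma bipartite_kernel:
  fixes N :: "'v \<Rightarrow> 'v set" and P :: "'v \<Rightarrow> bool"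
  assumes "finite S" and "\<And>u v. v \<in> S \<Longrightarrow> u \<in> N v \<Longrightarrow> P u \<noteq> P v"
  shows "\<exists>K\<subseteq>S. (\<forall>v\<in>K. N v \<inter> K = {}) \<and> (\<forall>v\<in>S - K. N v \<inter> K \<noteq> {})"
  using assms
proof (induction "card S" arbitrary: S rule: less_induct)
  case less
  show ?case
  proof (cases "\<forall>a\<in>S. P a \<longrightarrow> N a \<inter> {b\<in>S. \<not> P b} \<noteq> {}")
    case True
    have "\<forall>v\<in>{b\<in>S. \<not> P b}. N v \<inter> {b\<in>S. \<not> P b} = {}"
      using less.prems(2) by blast
    with True show ?thesis
      by (intro exI[of _ "{b\<in>S. \<not> P b}"]) auto
  next
    case False
    \<comment> \<open>Out-neighbors of \<open>a\<close> fail \<open>P\<close>, so having none among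
      the vertices of \<open>S\<close> without \<open>P\<close> makes \<open>a\<close> a sink of
      \<open>S\<close>.\<close>
    then obtain a where a: "a \<in> S" "P a" and sink: "N a \<inter> S = {}"
      using less.prems(2) by blast
    define S' where "S' = S - {a} - {b. a \<in> N b}"
    have "S' \<subset> S" using a by (auto simp: S'_def)
    then have "card S' < card S" "finite S'"
      using less.prems(1) by (auto intro: psubset_card_mono finite_subset)
    then obtain K where K: "K \<subseteq> S'" "\<forall>v\<in>K. N v \<inter> K = {}" "\<forall>v\<in>S' - K. N v \<inter> K \<noteq> {}"
      using less.hyps[of S'] less.prems(2) \<open>S' \<subset> S\<close> by blast
    have "\<forall>v\<in>insert a K. N v \<inter> insert a K = {}"
      using K(1,2) sink a by (auto simp: S'_def)
    moreover have "\<forall>v\<in>S - insert a K. N v \<inter> insert a K \<noteq> {}"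
      using K(3) by (auto simp: S'_def)
    ultimately show ?thesis
      using K(1) \<open>S' \<subset> S\<close> a by (intro exI[of _ "insert a K"]) auto
  qed
qed

text \<open>Color one kernel at a time: a kernel of the vertices that list \<open>c\<close> receives
  \<open>c\<close>. Any other vertex losing \<open>c\<close> from its list also loses an
  out-neighbor, so the strict inequality survives.\<close>

lemma bipartite_list_coloring:
  fixes N :: "'v \<Rightarrow> 'v set" and P :: "'v \<Rightarrow> bool" and L :: "'v \<Rightarrow> 'c set"
  assumes "finite S" and "\<And>u v. v \<in> S \<Longrightarrow> u \<in> N v \<Longrightarrow> P u \<noteq> P v"
    and "\<And>v. v \<in> S \<Longrightarrow> card (N v \<inter> S) < card (L v)"
  shows "\<exists>f. \<forall>v\<in>S. f v \<in> L v \<and> (\<forall>u\<in>N v \<inter> S. f u \<noteq> f v)"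
  using assms
proof (induction "card S" arbitrary: S L rule: less_induct)
  case less
  show ?case
  proof (cases "S = {}")
    case False
    then obtain v0 where v0: "v0 \<in> S" by blast
    then have "L v0 \<noteq> {}" using less.prems(3)[of v0] by auto
    then obtain c where c: "c \<in> L v0" by blast
    define T where "T = {v\<in>S. c \<in> L v}"
    have "finite T" using less.prems(1) by (simp add: T_def)
    then obtain K where K: "K \<subseteq> T" "\<forall>v\<in>K. N v \<inter> K = {}" "\<forall>v\<in>T - K. N v \<inter> K \<noteq> {}"
      using bipartite_kernel[of T N P] less.prems(2) by (auto simp: T_def)
    have "v0 \<in> T" using v0 c by (simp add: T_def)
    \<comment> \<open>A nonempty set has no empty absorbing subset; this makes the induction
      progress.\<close>
    then have "K \<noteq> {}" using K(3) by blast
    then have lt: "S - K \<subset> S" using K(1) by (auto simp: T_def)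
    have cards: "card (N v \<inter> (S - K)) < card (L v - {c})" if v: "v \<in> S - K" for v
    proof (cases "c \<in> L v")
      case True
      then have "N v \<inter> K \<noteq> {}" using K(3) v by (auto simp: T_def)
      then have "N v \<inter> (S - K) \<subset> N v \<inter> S" using K(1) by (auto simp: T_def)
      then have "card (N v \<inter> (S - K)) < card (N v \<inter> S)"
        using less.prems(1) by (intro psubset_card_mono) auto
      then show ?thesis
        using less.prems(3)[of v] v True by (simp add: card_Diff_singleton)
    next
      case False
      have "card (N v \<inter> (S - K)) \<le> card (N v \<inter> S)"
        using less.prems(1) by (intro card_mono) auto
      then show ?thesis using less.prems(3)[of v] v False by simp
    qed
    have "card (S - K) < card S" using lt less.prems(1) by (rule psubset_card_mono[rotated])
    then obtain f where
      f: "\<forall>v\<in>S - K. f v \<in> L v - {c} \<and> (\<forall>u\<in>N v \<inter> (S - K). f u \<noteq> f v)"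
      using less.hyps[of "S - K" "\<lambda>v. L v - {c}"] less.prems(1,2) cards by auto
    define g where "g = (\<lambda>v. if v \<in> K then c else f v)"
    have "g v \<in> L v \<and> (\<forall>u\<in>N v \<inter> S. g u \<noteq> g v)" if "v \<in> S" for v
    proof (cases "v \<in> K")
      case True
      then have "c \<in> L v" "N v \<inter> K = {}" using K(1,2) by (auto simp: T_def)
      moreover have "f u \<noteq> c" if "u \<in> S - K" for u using f that by blast
      ultimately show ?thesis using True by (auto simp: g_def)
    next
      case False
      then have "f v \<in> L v" "f v \<noteq> c" "\<forall>u\<in>N v \<inter> (S - K). f u \<noteq> f v" using f that by auto
      then show ?thesis using False by (auto simp: g_def)
    qed
    then show ?thesis by blast
  qed simp
qed

lemma sum_axis:
  fixes c :: "'d::finite \<Rightarrow> 'a::semiring_1"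
  shows "(\<Sum>j\<in>UNIV. c j * axis i a $ j) = c i * a"
proof -
  have "(\<Sum>j\<in>UNIV. c j * axis i a $ j) = (\<Sum>j\<in>UNIV. if j = i then c i * a else 0)"
    by (intro sum.cong) (auto simp: axis_def)
  then show ?thesis by simp
qed

lemma finite_int_box: "finite {v :: int ^ 'd. \<forall>i. v $ i \<in> {a..b}}"
proof (rule finite_imageD)
  show "finite (vec_nth ` {v :: int ^ 'd. \<forall>i. v $ i \<in> {a..b}})"
    by (rule finite_subset[of _ "PiE UNIV (\<lambda>_. {a..b})"]) (auto intro: finite_PiE)
  show "inj_on vec_nth {v :: int ^ 'd. \<forall>i. v $ i \<in> {a..b}}"
    by (auto simp: inj_on_def vec_nth_inject)
qed

section \<open>Frozen linear colorings\<close>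

lemma frozen_coloring_exists:
  assumes "2 \<le> q" "q \<le> CARD('d) + 1"
  shows "\<exists>x :: int ^ 'd \<Rightarrow> nat. frozen_coloring q x"
proof -
  have "\<exists>g. bij_betw g (UNIV :: 'd set) {0..<CARD('d)}"
    using ex_bij_betw_finite_nat[of "UNIV :: 'd set"] by simp
  then obtain g where g: "bij_betw g (UNIV :: 'd set) {0..<CARD('d)}" by blast
  \<comment> \<open>\<open>g\<close> takes all values up to \<open>d - 1\<close>, and
    \<open>q - 2 \<le> d - 1\<close>; capping at \<open>q - 2\<close> and adding 1 thus yields
    exactly the nonzero residues modulo \<open>q\<close>.\<close>
  define s :: "'d \<Rightarrow> int" where "s i = int (min (g i) (q - 2)) + 1" for i
  have s_bounds: "0 < s i" "s i < int q" for i
    using assms by (auto simp: s_def)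
  have s_onto: "\<exists>i. s i = r" if "0 < r" "r < int q" for r
  proof -
    have "nat (r - 1) \<in> g ` UNIV"
      using g that assms by (auto simp: bij_betw_def)
    then obtain i where "nat (r - 1) = g i" by blast
    then show ?thesis using that by (intro exI[of _ i]) (auto simp: s_def)
  qed
  define h :: "int ^ 'd \<Rightarrow> int" where "h v = (\<Sum>i\<in>UNIV. s i * v $ i)" for v
  define x where "x v = nat (h v mod int q)" for v
  have h_add: "h (v + axis i 1) = h v + s i" for v i
    using sum_axis[of s i 1] by (simp add: h_def algebra_simps sum.distrib)
  have x_int: "int (x v) = h v mod int q" for v
    using assms by (simp add: x_def)
  have x_less: "x v < q" for v
    using x_int[of v] pos_mod_bound[of "int q" "h v"] assms by linarith
  have step: "x (v + axis i 1) \<noteq> x v" for v i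
  proof
    assume "x (v + axis i 1) = x v"
    then have "(h v + s i) mod int q = h v mod int q"
      using x_int[of v] x_int[of "v + axis i 1"] h_add[of v i] by simp
    then have "int q dvd s i"
      by (simp add: mod_eq_dvd_iff)
    then show False using s_bounds[of i] zdvd_not_zless by blast
  qed
  have proper: "proper_coloring grid_adj q x"
    using x_less step unfolding proper_coloring_def grid_adj_def by (auto; metis)
  moreover have "y = x"
    if y: "proper_coloring grid_adj q y" and fin: "finite {v. y v \<noteq> x v}" for y
  proof (rule ccontr)
    assume "y \<noteq> x"
    then have ne: "{v. y v \<noteq> x v} \<noteq> {}" by (auto simp: fun_eq_iff)
    define t :: "int ^ 'd \<Rightarrow> int" where "t v = (\<Sum>i\<in>UNIV. v $ i)" for v
    obtain v where v: "y v \<noteq> x v" and max: "\<And>w. y w \<noteq> x w \<Longrightarrow> t w \<le> t v"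
    proof -
      have "Max (t ` {v. y v \<noteq> x v}) \<in> t ` {v. y v \<noteq> x v}"
        using fin ne by (intro Max_in) auto
      then obtain v where v: "y v \<noteq> x v" "t v = Max (t ` {v. y v \<noteq> x v})" by auto
      have "t w \<le> t v" if "y w \<noteq> x w" for w
        unfolding v(2) using fin that by (intro Max_ge) auto
      with v(1) show ?thesis by (rule that)
    qed
    \<comment> \<open>The step that turns the color \<open>x v\<close> into \<open>y v\<close>: the
      forward neighbor in a direction with this step has color \<open>y v\<close> under
      \<open>x\<close>, and by maximality also under \<open>y\<close>.\<close>
    define r where "r = (int (y v) - int (x v)) mod int q"
    have yq: "y v < q" using y by (simp add: proper_coloring_def)
    have "r \<noteq> 0"
    proof
      assume "r = 0"
      then have "int (y v) mod int q = int (x v) mod int q"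
        unfolding r_def by (simp add: mod_eq_dvd_iff mod_eq_0_iff_dvd)
      then show False using v yq x_less[of v] by simp
    qed
    moreover have "0 \<le> r" "r < int q"
      using assms by (auto simp: r_def)
    ultimately have "0 < r" "r < int q" by auto
    then obtain i where i: "s i = r" using s_onto by blast
    have "int (x (v + axis i 1)) = (int (x v) + r) mod int q"
      unfolding x_int h_add i by (simp add: mod_add_left_eq)
    also have "\<dots> = int (y v)"
      using yq by (simp add: r_def mod_add_right_eq)
    finally have same: "x (v + axis i 1) = y v" by simp
    have "t (v + axis i 1) = t v + 1"
      using sum_axis[of "\<lambda>_. 1" i "1::int"] by (simp add: t_def sum.distrib)
    then have "y (v + axis i 1) = x (v + axis i 1)" using max[of "v + axis i 1"] by force
    moreover have "y v \<noteq> y (v + axis i 1)"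
      using y unfolding proper_coloring_def grid_adj_def by blast
    ultimately show False using same by simp
  qed
  ultimately show ?thesis unfolding frozen_coloring_def by blast
qed

section \<open>Recoloring a box\<close>

lemma frozen_coloring_bound:
  fixes x :: "int ^ 'd \<Rightarrow> nat"
  assumes "frozen_coloring q x"
  shows "q \<le> CARD('d) + 1"
proof (rule ccontr)
  assume "\<not> q \<le> CARD('d) + 1"
  then have q: "q \<ge> CARD('d) + 2" by simp
  have proper: "proper_coloring grid_adj q x"
    and frozen: "\<And>y. proper_coloring grid_adj q y \<Longrightarrow> finite {v. y v \<noteq> x v} \<Longrightarrow> y = x"
    using assms by (auto simp: frozen_coloring_def)
  define d where "d = int CARD('d)"
  have d: "d > 0" by (simp add: d_def)
  have "\<exists>g. bij_betw g (UNIV :: 'd set) {0..<CARD('d)}"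
    using ex_bij_betw_finite_nat[of "UNIV :: 'd set"] by simp
  then obtain g where g: "bij_betw g (UNIV :: 'd set) {0..<CARD('d)}" by blast
  \<comment> \<open>Labels are distinct, so a vertex is the source in at most one direction, and
    nonzero modulo \<open>d + 1\<close>, so the origin is never a source.\<close>
  define label :: "'d \<Rightarrow> int" where "label i = int (g i) + 1" for i
  have label_bounds: "0 < label i" "label i \<le> d" for i
    using bij_betwE[OF g, rule_format, of i] by (auto simp: label_def d_def)
  have label_inj: "i = j" if "label i = label j" for i j
    using that g by (auto simp: label_def bij_betw_def inj_on_def)
  define t :: "int ^ 'd \<Rightarrow> int" where "t v = (\<Sum>i\<in>UNIV. v $ i)" for v
  have t_add: "t (v + axis i a) = t v + a" for v i a
    using sum_axis[of "\<lambda>_. 1" i a] by (simp add: t_def sum.distrib)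
  \<comment> \<open>The \<open>i\<close>-th coordinate of the source on the line through \<open>v\<close> in direction \<open>i\<close>.\<close>
  define p where "p i v = (label i - (t v - v $ i)) mod (d + 1)" for i v
  have p_add: "p i (v + axis i a) = p i v" for i v a
    by (simp add: p_def t_add)
  have p_bounds: "0 \<le> p i v" "p i v \<le> d" for i v
    using d pos_mod_bound[of "d + 1" "label i - (t v - v $ i)"] by (auto simp: p_def)
  have source: "t v mod (d + 1) = label i" if "v $ i = p i v" for i v
  proof -
    have "t v mod (d + 1) = ((t v - v $ i) + p i v) mod (d + 1)" using that by simp
    also have "\<dots> = label i mod (d + 1)" unfolding p_def by (simp add: mod_add_right_eq)
    also have "\<dots> = label i" using label_bounds[of i] by simp
    finally show ?thesis .
  qed
  define B where "B = {v :: int ^ 'd. \<forall>i. v $ i \<in> {0..d}}"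
  have B_bounds: "0 \<le> v $ i" "v $ i \<le> d" if "v \<in> B" for v i
    using that by (auto simp: B_def)
  have fin_B: "finite B" unfolding B_def by (rule finite_int_box)
  \<comment> \<open>\<open>N\<close> follows the arcs away from the source, in both directions at
    the source itself; for \<open>v\<close> in \<open>B\<close>, \<open>E\<close> collects the
    neighbors outside \<open>B\<close>.\<close>
  define N where "N v = (\<lambda>i. v + axis i 1) ` {i. p i v \<le> v $ i \<and> v $ i < d}
    \<union> (\<lambda>i. v + axis i (-1)) ` {i. v $ i \<le> p i v \<and> 0 < v $ i}" for v :: "int ^ 'd"
  define E where "E v = (\<lambda>i. v + axis i 1) ` {i. v $ i = d}
    \<union> (\<lambda>i. v + axis i (-1)) ` {i. v $ i = 0}" for v :: "int ^ 'd"
  define L where "L v = {0..<q} - x ` E v - (if v = 0 then {x 0} else {})" for v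
  have degree: "card (N v) + card (E v) \<le> CARD('d) + (if v = 0 then 0 else 1)" for v
  proof -
    have card_Collect: "card {i. Q i} = (\<Sum>i\<in>UNIV. of_bool (Q i))" for Q :: "'d \<Rightarrow> bool"
      by simp
    have card_union: "card (f ` X \<union> h ` Y) \<le> card X + card Y"
      for f h :: "'d \<Rightarrow> int ^ 'd" and X Y
      by (meson add_mono card_Un_le card_image_le finite order_trans)
    have "card (N v) + card (E v) \<le>
        (card {i. p i v \<le> v $ i \<and> v $ i < d} + card {i. v $ i \<le> p i v \<and> 0 < v $ i})
        + (card {i. v $ i = d} + card {i. v $ i = 0})"
      unfolding N_def E_def by (intro add_mono card_union)
    also have "\<dots> = (\<Sum>i\<in>UNIV. of_bool (p i v \<le> v $ i \<and> v $ i < d)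
        + of_bool (v $ i \<le> p i v \<and> 0 < v $ i) + of_bool (v $ i = d) + of_bool (v $ i = 0))"
      unfolding card_Collect sum.distrib by simp
    \<comment> \<open>Each direction contributes at most one neighbor to \<open>N\<close> or
      \<open>E\<close>, and a second only if \<open>v\<close> is its source.\<close>
    also have "\<dots> \<le> (\<Sum>i\<in>UNIV. 1 + of_bool (v $ i = p i v))"
    proof (rule sum_mono)
      fix i
      show "of_bool (p i v \<le> v $ i \<and> v $ i < d) + of_bool (v $ i \<le> p i v \<and> 0 < v $ i)
          + of_bool (v $ i = d) + of_bool (v $ i = 0) \<le> (1 + of_bool (v $ i = p i v) :: nat)"
        using d p_bounds[of i v] by (auto simp: of_bool_def)
    qed
    also have "\<dots> = CARD('d) + card {i. v $ i = p i v}"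
      unfolding card_Collect sum.distrib by simp
    finally have le: "card (N v) + card (E v) \<le> CARD('d) + card {i. v $ i = p i v}" .
    show ?thesis
    proof (cases "v = 0")
      case True
      then have "t v mod (d + 1) = 0" by (simp add: t_def)
      then have "{i. v $ i = p i v} = {}"
        using source label_bounds by (metis (mono_tags, lifting) Collect_empty_eq less_irrefl)
      then show ?thesis using le True by simp
    next
      case False
      have "i = j" if "v $ i = p i v" "v $ j = p j v" for i j
        using source[OF that(1)] source[OF that(2)] by (intro label_inj) simp
      then have "card {i. v $ i = p i v} \<le> 1"
        unfolding One_nat_def card_le_Suc0_iff_eq[OF finite] by blast
      then show ?thesis using le False by simp
    qed
  qed
  have fin_E: "finite (E v)" and fin_N: "finite (N v)" for v
    by (auto simp: E_def N_def)
  \<comment> \<open>Deleting the colors on \<open>E v\<close>, and \<open>x 0\<close> at the origin,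
    costs exactly what \<open>degree\<close> saves; \<open>q \<ge> d + 2\<close> makes the
    inequality strict.\<close>
  have "card (N v \<inter> B) < card (L v)" for v
  proof -
    have "card (N v \<inter> B) \<le> card (N v)" using fin_N by (intro card_mono) auto
    moreover have "q - card (E v) \<le> card ({0..<q} - x ` E v)"
      using diff_card_le_card_Diff[of "x ` E v" "{0..<q}"] card_image_le[OF fin_E, of x v] fin_E
      by simp
    moreover have "card ({0..<q} - x ` E v) - (if v = 0 then 1 else 0) \<le> card (L v)"
      unfolding L_def using diff_card_le_card_Diff[of "{x 0}" "{0..<q} - x ` E v"] by auto
    ultimately show ?thesis using degree[of v] q by (auto split: if_splits)
  qed
  \<comment> \<open>Arcs change the coordinate sum by one, so its parity is a bipartition.\<close>
  moreover have "even (t u) \<noteq> even (t v)" if "u \<in> N v" for u v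
    using that by (auto simp: N_def t_add)
  ultimately have "\<exists>f. \<forall>v\<in>B. f v \<in> L v \<and> (\<forall>u\<in>N v \<inter> B. f u \<noteq> f v)"
    by (intro bipartite_list_coloring[OF fin_B, of N "\<lambda>v. even (t v)"])
  then obtain f where f: "\<And>v. v \<in> B \<Longrightarrow> f v \<in> L v"
      "\<And>u v. v \<in> B \<Longrightarrow> u \<in> N v \<Longrightarrow> u \<in> B \<Longrightarrow> f u \<noteq> f v"
    by auto
  have avoids: "x u \<noteq> f v" if "v \<in> B" "u \<in> E v" for u v
  proof -
    have "f v \<notin> x ` E v" using f(1)[OF that(1)] by (simp add: L_def)
    then show ?thesis using imageI[OF that(2), of x] by metis
  qed
  define y where "y v = (if v \<in> B then f v else x v)" for v
  have edge: "y v \<noteq> y (v + axis i 1)" for v i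
  proof -
    define w where "w = v + axis i 1"
    have wi: "w $ i = v $ i + 1" by (simp add: w_def axis_def)
    have wj: "w $ j = v $ j" if "j \<noteq> i" for j using that by (simp add: w_def axis_def)
    have vw: "v = w + axis i (-1)" by (simp add: w_def vec_eq_iff axis_def)
    have pw: "p i w = p i v" by (simp add: w_def p_add)
    have xvw: "x v \<noteq> x w"
      using proper unfolding proper_coloring_def grid_adj_def w_def by blast
    consider "v \<in> B" "w \<in> B" | "v \<in> B" "w \<notin> B" | "v \<notin> B" "w \<in> B" | "v \<notin> B" "w \<notin> B"
      by blast
    then have "y v \<noteq> y w"
    proof cases
      case 1
      have "v $ i < d" "0 < w $ i" using 1 wi B_bounds[of v i] B_bounds[of w i] by auto
      \<comment> \<open>Both ends share the source coordinate \<open>p i v\<close>; the edge points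
        forward if it is at most \<open>v $ i\<close>, and backward otherwise.\<close>
      have "w \<in> N v \<or> v \<in> N w"
      proof (cases "p i v \<le> v $ i")
        case True
        then show ?thesis using \<open>v $ i < d\<close> by (auto simp: N_def w_def)
      next
        case False
        then have "v \<in> (\<lambda>i. w + axis i (-1)) ` {i. w $ i \<le> p i w \<and> 0 < w $ i}"
          using \<open>0 < w $ i\<close> wi pw by (intro image_eqI[where x = i] vw) auto
        then show ?thesis unfolding N_def by blast
      qed
      then show ?thesis using f(2) 1 by (force simp: y_def)
    next
      case 2
      \<comment> \<open>Only coordinate \<open>i\<close> changes along the edge, so it leaves the
        box through the upper face.\<close>
      have "v $ i = d"
        using 2 wi wj unfolding B_def by (smt (verit) atLeastAtMost_iff mem_Collect_eq)
      then have "w \<in> E v" by (auto simp: E_def w_def)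
      then have "x w \<noteq> f v" by (rule avoids[OF 2(1)])
      then show ?thesis using 2 by (simp add: y_def)
    next
      case 3
      have "w $ i = 0"
        using 3 wi wj unfolding B_def by (smt (verit) atLeastAtMost_iff mem_Collect_eq)
      then have "v \<in> (\<lambda>i. w + axis i (-1)) ` {i. w $ i = 0}"
        by (intro image_eqI[where x = i] vw) simp
      then have "v \<in> E w" unfolding E_def by blast
      then have "x v \<noteq> f w" by (rule avoids[OF 3(2)])
      then show ?thesis using 3 by (simp add: y_def)
    next
      case 4
      then show ?thesis using xvw by (simp add: y_def)
    qed
    then show ?thesis by (simp add: w_def)
  qed
  have "y v < q" for v
    using f(1)[of v] proper by (auto simp: y_def L_def proper_coloring_def)
  then have "proper_coloring grid_adj q y"
    using edge unfolding proper_coloring_def grid_adj_def by (auto; metis)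
  moreover have "finite {v. y v \<noteq> x v}"
    by (rule finite_subset[OF _ fin_B]) (auto simp: y_def)
  ultimately have "y = x" by (rule frozen)
  moreover have "0 \<in> B" using d by (simp add: B_def)
  then have "y 0 \<noteq> x 0" using f(1)[of 0] by (simp add: y_def L_def)
  ultimately show False by simp
qed

theorem theorem1p1:
  fixes q :: nat
  assumes "q \<ge> 2"
  shows "(\<exists>x :: int ^ 'd \<Rightarrow> nat. frozen_coloring q x) \<longleftrightarrow> 2 \<le> q \<and> q \<le> CARD('d) + 1"
  using assms frozen_coloring_exists frozen_coloring_bound by blast

end
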